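(* Even if cancellation is allowed, no randomized policy has a robustness ratio better than $8/9$ ($>0.888$) for the knapsack problem with an unknown capacity. That is, for every $\alpha>8/9$ there is an instance of the knapsack problem with an unknown capacity for which no randomized adaptive policy (with cancellation) is $\alpha$-robust.
   Context: Knapsack problem with an unknown capacity: an instance is a finite set $I$ of items, each item $i$ having a positive integer size $s(i)$ and a nonnegative weight $w(i)$; the objective is $f(X)=\sum_{i\in X}w(i)$. The capacity $C$ is unknown. Items are tried one at a time, each at most once. When item $i$ is tried and the current knapsack content is $X$, we learn whether $s(X)+s(i)\le C$, where $s(X)=\sum_{j\in X}s(j)$. If so, $i$ is irrevocably added to $X$; otherwise (with cancellation) $i$ is discarded and the process continues with the remaining items. An adaptive policy is a binary decision tree specifying the next item to try depending on the observations so far; a randomized policy is a probability distribution over such decision trees. Let $\mathrm{ALG}_C$ be the (random) final knapsack content when the capacity is $C$ and let $\mathrm{OPT}_C$ maximize $f(X)$ over $X\subseteq I$ with $s(X)\le C$. The policy is $\alpha$-robust if $\mathbb{E}[f(\mathrm{ALG}_C)]\ge\alpha f(\mathrm{OPT}_C)$ for every $C\in\mathbb{R}_+$. *)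

theory Defs
  imports "HOL-Probability.Probability"
begin

definition knapsack_instance :: "'a set \<Rightarrow> ('a \<Rightarrow> nat) \<Rightarrow> ('a \<Rightarrow> real) \<Rightarrow> bool" where
  "knapsack_instance I s w \<longleftrightarrow> finite I \<and> (\<forall>i\<in>I. s i > 0) \<and> (\<forall>i\<in>I. w i \<ge> 0)"

definition opt_value :: "'a set \<Rightarrow> ('a \<Rightarrow> nat) \<Rightarrow> ('a \<Rightarrow> real) \<Rightarrow> real \<Rightarrow> real" where
  "opt_value I s w C = Max {sum w X | X. X \<subseteq> I \<and> real (sum s X) \<le> C}"

text \<open>In \<open>Try i T U\<close>, the process continues with \<open>T\<close> if item \<open>i\<close> fits (and is then added
  to the knapsack) and with \<open>U\<close> if it does not fit (and is then discarded). As \<open>Stop\<close> may occur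
  anywhere, policies that end the process at the first failure are included.\<close>

datatype 'a policy = Stop | Try 'a "'a policy" "'a policy"

text \<open>The set argument consists of the items that have not been tried so far.\<close>

primrec valid_policy :: "'a set \<Rightarrow> 'a policy \<Rightarrow> bool" where
  "valid_policy A Stop \<longleftrightarrow> True"
| "valid_policy A (Try i T U) \<longleftrightarrow>
     i \<in> A \<and> valid_policy (A - {i}) T \<and> valid_policy (A - {i}) U"

primrec run_policy :: "('a \<Rightarrow> nat) \<Rightarrow> real \<Rightarrow> 'a policy \<Rightarrow> 'a set \<Rightarrow> 'a set" where
  "run_policy s C Stop X = X"
| "run_policy s C (Try i T U) X =
     (if real (sum s X + s i) \<le> C then run_policy s C T (insert i X) else run_policy s C U X)"

text \<open>A finite item set admits only finitely many valid decision trees, so discrete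
  distributions cover all randomized policies.\<close>

definition randomized_policy :: "'a set \<Rightarrow> 'a policy pmf \<Rightarrow> bool" where
  "randomized_policy I P \<longleftrightarrow> (\<forall>T\<in>set_pmf P. valid_policy I T)"

definition robust ::
  "'a set \<Rightarrow> ('a \<Rightarrow> nat) \<Rightarrow> ('a \<Rightarrow> real) \<Rightarrow> real \<Rightarrow> 'a policy pmf \<Rightarrow> bool" where
  "robust I s w \<alpha> P \<longleftrightarrow>
     (\<forall>C\<ge>0. measure_pmf.expectation P (\<lambda>T. sum w (run_policy s C T {})) \<ge> \<alpha> * opt_value I s w C)"

end

theory Submission imports Defs begin

text \<open>Take items of sizes 2, 3, 4 and weights 3, 3, 4. At capacity 4 the optimum is the third item
  alone (value 4), at capacity 5 it consists of the first two (value 6). A policy has to choose its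
  first item, which fits in both cases, without knowing the capacity: if it is the third item, the
  final values are 4 and 4; otherwise they are at most 3 and 6. Either way twice the first value
  plus the second is at most 12, so averaging gives \<open>2 * 4\<alpha> + 6\<alpha> \<le> 12\<close>, that is,
  \<open>\<alpha> \<le> 6/7 < 8/9\<close>.\<close>

text \<open>Accepted items are never removed. This is what lets the choice of the first item
  constrain the final content.\<close>

lemma subset_run_policy: "X \<subseteq> run_policy s C T X"
proof (induction T arbitrary: X)
  case (Try i T U)
  then show ?case by (metis insert_subset run_policy.simps(2))
qed simp

lemma run_policy_subset: "valid_policy A T \<Longrightarrow> run_policy s C T X \<subseteq> X \<union> A"
proof (induction T arbitrary: X A)
  case (Try i T U)
  then have "i \<in> A" "run_policy s C T (insert i X) \<subseteq> insert i X \<union> (A - {i})"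
    "run_policy s C U X \<subseteq> X \<union> (A - {i})"
    by auto
  then show ?case by auto
qed simp

text \<open>Induction on the tree. Disjointness of \<open>X\<close> and \<open>A\<close> makes every
  tried item new, so the tested number \<open>sum s X + s i\<close> really is the size of
  \<open>insert i X\<close>.\<close>

lemma size_run_policy_le:
  assumes "valid_policy A T" "finite X" "X \<inter> A = {}" "real (sum s X) \<le> C"
  shows "real (sum s (run_policy s C T X)) \<le> C"
  using assms
proof (induction T arbitrary: X A)
  case Stop
  then show ?case by simp
next
  case (Try i T U)
  have "i \<notin> X" using Try.prems by auto
  then have ins: "sum s (insert i X) = sum s X + s i"
    using Try.prems(2) by simp
  show ?case
  proof (cases "real (sum s X + s i) \<le> C")
    case True
    have "real (sum s (run_policy s C T (insert i X))) \<le> C"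
      using Try.prems True ins by (intro Try.IH(1)[of "A - {i}"]) auto
    with True show ?thesis by simp
  next
    case False
    have "real (sum s (run_policy s C U X)) \<le> C"
      using Try.prems by (intro Try.IH(2)[of "A - {i}"]) auto
    with False show ?thesis by simp
  qed
qed

lemma opt_value_ge:
  assumes "finite I" "X \<subseteq> I" "real (sum s X) \<le> C"
  shows "sum w X \<le> opt_value I s w C"
  unfolding opt_value_def
proof (rule Max_ge)
  have "{sum w X | X. X \<subseteq> I \<and> real (sum s X) \<le> C} \<subseteq> sum w ` Pow I"
    by auto
  then show "finite {sum w X | X. X \<subseteq> I \<and> real (sum s X) \<le> C}"
    using assms(1) finite_surj by blast
qed (use assms in auto)

text \<open>A valid tree packs only items of \<open>I\<close>, so the final value is bounded by
  their total absolute weight. Integrability is what later permits linearity of expectation.\<close>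

lemma integrable_run_policy:
  fixes w :: "'a \<Rightarrow> real"
  assumes "randomized_policy I P" "finite I"
  shows "integrable (measure_pmf P) (\<lambda>T. sum w (run_policy s C T {}))"
proof (rule measure_pmf.integrable_const_bound)
  show "AE T in measure_pmf P. norm (sum w (run_policy s C T {})) \<le> (\<Sum>i\<in>I. \<bar>w i\<bar>)"
  proof (rule AE_pmfI)
    fix T assume "T \<in> set_pmf P"
    then have sub: "run_policy s C T {} \<subseteq> I"
      using assms(1) run_policy_subset[of I T s C "{}"] by (auto simp: randomized_policy_def)
    have "norm (sum w (run_policy s C T {})) \<le> (\<Sum>i\<in>run_policy s C T {}. \<bar>w i\<bar>)"
      by simp
    also have "\<dots> \<le> (\<Sum>i\<in>I. \<bar>w i\<bar>)"
      using sub assms(2) by (intro sum_mono2) auto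
    finally show "norm (sum w (run_policy s C T {})) \<le> (\<Sum>i\<in>I. \<bar>w i\<bar>)" .
  qed
qed simp

text \<open>Easy direction of Yao's principle: a bound on a weighted sum of the values at two
  capacities that holds for every deterministic tree survives averaging over \<open>P\<close>, while
  robustness bounds each of the two expectations from below.\<close>

lemma robust_averaging_bound:
  fixes w :: "'a \<Rightarrow> real"
  assumes P: "randomized_policy I P" "robust I s w \<alpha> P" and "finite I" "C \<ge> 0" "D \<ge> 0" "p \<ge> 0" "q \<ge> 0"
    and bound: "\<And>T. valid_policy I T \<Longrightarrow>
      p * sum w (run_policy s C T {}) + q * sum w (run_policy s D T {}) \<le> B"
  shows "\<alpha> * (p * opt_value I s w C + q * opt_value I s w D) \<le> B"
proof -
  let ?f = "\<lambda>C T. sum w (run_policy s C T {})"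
  have int: "integrable (measure_pmf P) (?f C)" for C
    by (rule integrable_run_policy[OF P(1) \<open>finite I\<close>])
  have rob: "\<alpha> * opt_value I s w C \<le> measure_pmf.expectation P (?f C)" if "C \<ge> 0" for C
    using P(2) that by (auto simp: robust_def)
  have "\<alpha> * (p * opt_value I s w C + q * opt_value I s w D) =
      p * (\<alpha> * opt_value I s w C) + q * (\<alpha> * opt_value I s w D)"
    by (simp add: algebra_simps)
  also have "\<dots> \<le> p * measure_pmf.expectation P (?f C) + q * measure_pmf.expectation P (?f D)"
    using rob assms by (intro add_mono mult_left_mono) auto
  also have "\<dots> = measure_pmf.expectation P (\<lambda>T. p * ?f C T + q * ?f D T)"
    using int by simp
  \<comment> \<open>The bound holds pointwise on the support, which contains only valid
    trees.\<close>
  also have "\<dots> \<le> B"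
    using int P(1) bound
    by (intro measure_pmf.integral_le_const AE_pmfI) (auto simp: randomized_policy_def)
  finally show ?thesis .
qed

definition item_size :: "nat \<Rightarrow> nat" where
  "item_size i = (if i = 0 then 2 else if i = 1 then 3 else 4)"

definition item_weight :: "nat \<Rightarrow> real" where
  "item_weight i = (if i = 2 then 4 else 3)"

text \<open>Any two items have total size at least 5, so within size 4 the item \<open>i\<close> is
  alone. Within size 5 the only pair that fits is \<open>{0, 1}\<close>: item 2 stays alone, and the
  others reach at most 3 + 3. The proof checks all eight subsets.\<close>

lemma item_weight_le:
  assumes "Y \<subseteq> {0, 1, 2}" "i \<in> Y"
  shows "sum item_size Y \<le> 4 \<Longrightarrow> sum item_weight Y \<le> (if i = 2 then 4 else 3)"
    and "sum item_size Y \<le> 5 \<Longrightarrow> sum item_weight Y \<le> (if i = 2 then 4 else 6)"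
proof -
  have "Y \<in> Pow {0, 1, 2}" using assms by simp
  then have Y: "Y \<in> {{}, {0}, {1}, {2}, {0, 1}, {0, 2}, {1, 2}, {0, 1, 2}}"
    unfolding Pow_insert Pow_empty by auto
  show "sum item_size Y \<le> 4 \<Longrightarrow> sum item_weight Y \<le> (if i = 2 then 4 else 3)"
    using Y assms(2) by (elim insertE emptyE) (simp_all add: item_size_def item_weight_def)
  show "sum item_size Y \<le> 5 \<Longrightarrow> sum item_weight Y \<le> (if i = 2 then 4 else 6)"
    using Y assms(2) by (elim insertE emptyE) (auto simp: item_size_def item_weight_def)
qed

text \<open>The factor 2 balances the two kinds of first item: 2 * 4 + 4 = 2 * 3 + 6 = 12.\<close>

lemma policy_tradeoff:
  assumes "valid_policy {0, 1, 2} T"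
  shows "2 * sum item_weight (run_policy item_size 4 T {}) +
    1 * sum item_weight (run_policy item_size 5 T {}) \<le> 12"
proof (cases T)
  case Stop
  then show ?thesis by simp
next
  case (Try i U V)
  \<comment> \<open>The largest size is 4, so from capacity 4 on the first test succeeds whichever
    item is tried.\<close>
  have first: "i \<in> run_policy item_size C T {}" if "C \<ge> 4" for C
    using that Try subset_run_policy[of "{i}" item_size C U] by (auto simp: item_size_def)
  have sub: "run_policy item_size C T {} \<subseteq> {0, 1, 2}" for C
    using run_policy_subset[OF assms, of item_size C "{}"] by simp
  have size: "real (sum item_size (run_policy item_size C T {})) \<le> C" if "C \<ge> 4" for C
    using that by (intro size_run_policy_le[OF assms]) auto
  let ?Y = "run_policy item_size 4 T {}" and ?Z = "run_policy item_size 5 T {}"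
  have "sum item_weight ?Y \<le> (if i = 2 then 4 else 3)"
    using size[of 4] by (intro item_weight_le(1)[OF sub first]) linarith+
  moreover have "sum item_weight ?Z \<le> (if i = 2 then 4 else 6)"
    using size[of 5] by (intro item_weight_le(2)[OF sub first]) linarith+
  ultimately show ?thesis by (auto split: if_splits)
qed

theorem theorem5:
  fixes \<alpha> :: real
  assumes "\<alpha> > 8 / 9"
  shows "\<exists>(I :: nat set) (s :: nat \<Rightarrow> nat) (w :: nat \<Rightarrow> real).
           knapsack_instance I s w \<and>
           \<not> (\<exists>P. randomized_policy I P \<and> robust I s w \<alpha> P)"
proof (intro exI conjI notI)
  let ?I = "{0, 1, 2} :: nat set"
  show "knapsack_instance ?I item_size item_weight"
    by (simp add: knapsack_instance_def item_size_def item_weight_def)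
  assume "\<exists>P. randomized_policy ?I P \<and> robust ?I item_size item_weight \<alpha> P"
  then obtain P where P: "randomized_policy ?I P" "robust ?I item_size item_weight \<alpha> P"
    by blast
  let ?opt = "opt_value ?I item_size item_weight"
  have "\<alpha> * (2 * ?opt 4 + 1 * ?opt 5) \<le> 12"
    using P by (rule robust_averaging_bound) (use policy_tradeoff in auto)
  moreover have "sum item_weight {2} \<le> ?opt 4" "sum item_weight {0, 1} \<le> ?opt 5"
    by (rule opt_value_ge; simp add: item_size_def)+
  then have "2 * ?opt 4 + 1 * ?opt 5 \<ge> 14"
    by (simp add: item_weight_def)
  \<comment> \<open>Multiplying by \<alpha> preserves the inequality because \<alpha> is positive.
    The contradiction then comes from 14 * 8/9 = 112/9 > 12.\<close>
  then have "\<alpha> * (2 * ?opt 4 + 1 * ?opt 5) \<ge> \<alpha> * 14"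
    using assms by (intro mult_left_mono) auto
  ultimately show False using assms by linarith
qed

end
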